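(* Let $X$ and $Y$ be reflexive and strictly convex real Banach spaces, let $A\colon X\to Y$ be a bounded linear operator, and let $(X_k)_k$, $X_k\colon Y\to X$, be any sequential regularization. Then for every $y\in Y$ we have $X_k\bigl(y-\pi_{\overline{\mathcal R(A)}}y\bigr)\to0$ as $k\to\infty$.
   Context: $\mathcal N(A)\subset X$ is the null-space and $\mathcal R(A)\subset Y$ the (not necessarily closed) range of $A$. For a closed linear subspace $U$ of a reflexive strictly convex Banach space $Z$, the metric projection $\pi_U\colon Z\to U$ maps $z$ to the unique element of $U$ with $\|z-\pi_U(z)\|=\inf_{u\in U}\|z-u\|$. The duality map is $J_X(x)=\{x'\in X':\langle x',x\rangle=\|x\|_X^2=\|x'\|_{X'}^2\}$, similarly $J_Y$. Put $C_X(A)=\{x\in X:J_X(x)\cap\mathcal N(A)^\perp\neq\emptyset\}$ and $C_Y(A)=\{y\in Y:J_Y(y)\cap\mathcal R(A)^\perp\neq\emptyset\}$ (annihilators in the dual spaces); $A$ maps $C_X(A)$ injectively onto $\mathcal R(A)$, and $y-\pi_{\overline{\mathcal R(A)}}y\in C_Y(A)$ for all $y\in Y$. The metric generalized inverse $A^\dagger$ has domain $\mathcal D(A^\dagger)=\mathcal R(A)+C_Y(A)=\{y\in Y:\pi_{\overline{\mathcal R(A)}}y\in\mathcal R(A)\}$ and is given by $A^\dagger y=(A|_{C_X(A)})^{-1}(\pi_{\overline{\mathcal R(A)}}y)$. A sequence of homogeneous mappings $X_k\colon Y\to X$ (i.e. $X_k(\lambda y)=\lambda X_k(y)$ for all $\lambda\in\mathbb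 R$) is called a (sequential) regularization if, as $k\to\infty$, $X_ky\to A^\dagger y$ for all $y\in\mathcal D(A^\dagger)$ and $AX_ky\to\pi_{\overline{\mathcal R(A)}}y$ for all $y\in Y$ (norm convergence). *)

theory Defs
  imports "HOL-Analysis.Analysis"
begin

definition reflexive_space :: "'a::real_normed_vector itself \<Rightarrow> bool" where
  "reflexive_space (_ :: 'a itself) \<longleftrightarrow>
     (\<forall>\<Phi> :: ('a \<Rightarrow>\<^sub>L real) \<Rightarrow>\<^sub>L real. \<exists>x::'a. \<forall>f. blinfun_apply \<Phi> f = blinfun_apply f x)"

definition strictly_convex_space :: "'a::real_normed_vector itself \<Rightarrow> bool" where
  "strictly_convex_space (_ :: 'a itself) \<longleftrightarrow>
     (\<forall>x y :: 'a. norm x = 1 \<longrightarrow> norm y = 1 \<longrightarrow> x \<noteq> y \<longrightarrow> norm (x + y) < 2)"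

(* Unspecified (via THE) unless z has exactly one best approximation in U; in a reflexive and
   strictly convex Banach space this is the case for every closed linear subspace U. *)
definition metric_proj :: "'a::real_normed_vector set \<Rightarrow> 'a \<Rightarrow> 'a" where
  "metric_proj U z = (THE u. u \<in> U \<and> norm (z - u) = (INF v\<in>U. norm (z - v)))"

definition duality_map :: "'a::real_normed_vector \<Rightarrow> ('a \<Rightarrow>\<^sub>L real) set" where
  "duality_map x = {f. blinfun_apply f x = (norm x)\<^sup>2 \<and> (norm x)\<^sup>2 = (norm f)\<^sup>2}"

definition annihilator :: "'a::real_normed_vector set \<Rightarrow> ('a \<Rightarrow>\<^sub>L real) set" where
  "annihilator S = {f. \<forall>x\<in>S. blinfun_apply f x = 0}"

definition null_space :: "('a::real_normed_vector \<Rightarrow> 'b::real_normed_vector) \<Rightarrow> 'a set" where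
  "null_space A = {x. A x = 0}"

definition C_X :: "('a::real_normed_vector \<Rightarrow> 'b::real_normed_vector) \<Rightarrow> 'a set" where
  "C_X A = {x. duality_map x \<inter> annihilator (null_space A) \<noteq> {}}"

definition C_Y :: "('a::real_normed_vector \<Rightarrow> 'b::real_normed_vector) \<Rightarrow> 'b set" where
  "C_Y A = {y. duality_map y \<inter> annihilator (range A) \<noteq> {}}"

definition mgi_domain :: "('a::real_normed_vector \<Rightarrow> 'b::real_normed_vector) \<Rightarrow> 'b set" where
  "mgi_domain A = {r + c | r c. r \<in> range A \<and> c \<in> C_Y A}"

(* Meaningful only on mgi_domain A, where the projection of y lies in range A and A maps C_X A
   bijectively onto range A. *)
definition metric_gen_inverse ::
    "('a::real_normed_vector \<Rightarrow> 'b::real_normed_vector) \<Rightarrow> 'b \<Rightarrow> 'a" where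
  "metric_gen_inverse A y = inv_into (C_X A) A (metric_proj (closure (range A)) y)"

definition sequential_regularization ::
    "('a::real_normed_vector \<Rightarrow> 'b::real_normed_vector) \<Rightarrow> (nat \<Rightarrow> 'b \<Rightarrow> 'a) \<Rightarrow> bool" where
  "sequential_regularization A R \<longleftrightarrow>
     (\<forall>k c y. R k (c *\<^sub>R y) = c *\<^sub>R R k y) \<and>
     (\<forall>y\<in>mgi_domain A. (\<lambda>k. R k y) \<longlonglongrightarrow> metric_gen_inverse A y) \<and>
     (\<forall>y. (\<lambda>k. A (R k y)) \<longlonglongrightarrow> metric_proj (closure (range A)) y)"

end

theory Submission
  imports Defs
begin

text \<open>
  Write \<open>U\<close> for the closure of the range of \<open>A\<close> and \<open>z = y - metric_proj U y\<close>. The residual \<open>z\<close>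
  lies in \<open>C_Y A\<close>, hence in the domain of the metric generalized inverse, and its own metric
  projection onto \<open>U\<close> is \<open>0\<close>. The generalized inverse thus sends \<open>z\<close> to the unique
  element of \<open>C_X A\<close> that \<open>A\<close> annihilates, which is \<open>0\<close>, and pointwise convergence of the
  regularization on the domain gives the claim.

  The functional-analytic content is that the residual does belong to \<open>C_Y A\<close>. Two facts are
  needed, both consequences of the Hahn-Banach theorem (\<open>hahn_banach_graph\<close>). First, best
  approximations in \<open>U\<close> exist (\<open>best_approximation_exists\<close>), by reflexivity; they are
  unique by strict convexity, so that \<open>metric_proj\<close> is meaningful and \<open>norm z\<close> is
  the distance of \<open>z\<close> to \<open>U\<close>. Second, a vector whose norm is its distance to a
  subspace has a duality functional vanishing on that subspace
  (\<open>nearest_zero_imp_duality_annihilator\<close>).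
\<close>

section \<open>The Hahn-Banach theorem\<close>

text \<open>
  The one-dimensional extension step. A partially defined functional is represented by its graph,
  a subspace of the product space, which the norm bound forces to be single-valued. The value \<open>c\<close> at the new vector \<open>x0\<close> is a supremum separating the lower
  bounds \<open>a - B * norm (x - x0)\<close> from the upper bounds \<open>B * norm (y + x0) - b\<close>.
\<close>

lemma norm_dominated_graph_extend:
  fixes G :: "('a::real_normed_vector \<times> real) set"
  assumes G: "subspace G" and dom: "\<And>x a. (x, a) \<in> G \<Longrightarrow> a \<le> B * norm x" and B: "0 \<le> B"
  shows "\<exists>H c. subspace H \<and> G \<subseteq> H \<and> (x0, c) \<in> H \<and> (\<forall>x a. (x, a) \<in> H \<longrightarrow> a \<le> B * norm x)"
proof -
  have sep: "a - B * norm (x - x0) \<le> B * norm (y + x0) - b"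
    if "(x, a) \<in> G" "(y, b) \<in> G" for x a y b
  proof -
    have "(x + y, a + b) \<in> G"
      using subspace_add[OF G that] by simp
    then have "a + b \<le> B * norm (x + y)"
      by (rule dom)
    also have "\<dots> \<le> B * (norm (x - x0) + norm (y + x0))"
      using norm_triangle_ineq[of "x - x0" "y + x0"] B by (intro mult_left_mono) auto
    finally show ?thesis by (simp add: algebra_simps)
  qed
  have zero: "(0, 0) \<in> G"
    using subspace_0[OF G] by (simp add: zero_prod_def)
  define L where "L = (\<lambda>(x, a). a - B * norm (x - x0)) ` G"
  have bdd: "bdd_above L"
    using sep[OF _ zero] by (auto simp: L_def intro!: bdd_aboveI)
  define c where "c = Sup L"
  have lower: "a - B * norm (x - x0) \<le> c" if "(x, a) \<in> G" for x a
    unfolding c_def using that by (intro cSup_upper bdd) (auto simp: L_def intro: rev_image_eqI)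
  have upper: "c \<le> B * norm (x + x0) - a" if "(x, a) \<in> G" for x a
    unfolding c_def using that sep zero by (intro cSup_least) (auto simp: L_def)
  define H where "H = span (insert (x0, c) G)"
  have "a \<le> B * norm x" if "(x, a) \<in> H" for x a
  proof -
    have "\<exists>t. (x, a) - t *\<^sub>R (x0, c) \<in> span G"
      using that span_breakdown_eq[of "(x, a)" "(x0, c)" G] by (simp add: H_def)
    then obtain t where t: "(x, a) - t *\<^sub>R (x0, c) \<in> G"
      using span_eq_iff[of G] G by metis
    then have g: "(x - t *\<^sub>R x0, a - t * c) \<in> G"
      by simp
    consider "t = 0" | "t > 0" | "t < 0" by linarith
    then show ?thesis
    proof cases
      case 1
      then show ?thesis using g dom by simp
    next
      case 2
      have "((1/t) *\<^sub>R (x - t *\<^sub>R x0), (1/t) * (a - t * c)) \<in> G"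
        using subspace_scale[OF G g, of "1/t"] by simp
      then have "c \<le> B * norm ((1/t) *\<^sub>R (x - t *\<^sub>R x0) + x0) - (1/t) * (a - t * c)"
        by (rule upper)
      also have "(1/t) *\<^sub>R (x - t *\<^sub>R x0) + x0 = (1/t) *\<^sub>R x"
        using 2 by (simp add: scaleR_diff_right)
      finally show ?thesis
        using 2 by (simp add: field_simps)
    next
      case 3
      define s where "s = - t"
      have s: "s > 0" using 3 by (simp add: s_def)
      have "((1/s) *\<^sub>R (x - t *\<^sub>R x0), (1/s) * (a - t * c)) \<in> G"
        using subspace_scale[OF G g, of "1/s"] by simp
      then have "(1/s) * (a - t * c) - B * norm ((1/s) *\<^sub>R (x - t *\<^sub>R x0) - x0) \<le> c"
        by (rule lower)
      also have "(1/s) *\<^sub>R (x - t *\<^sub>R x0) - x0 = (1/s) *\<^sub>R x"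
        using s by (simp add: s_def scaleR_diff_right)
      finally show ?thesis
        using s by (simp add: s_def field_simps)
    qed
  qed
  moreover have "subspace H" "G \<subseteq> H" "(x0, c) \<in> H"
    by (auto simp: H_def intro: span_base)
  ultimately show ?thesis by blast
qed

text \<open>
  By Zorn's lemma, every norm-dominated graph lies in a maximal one; the extension step shows that
  a maximal one has the whole space as its domain.
\<close>

theorem hahn_banach_graph:
  fixes G :: "('a::real_normed_vector \<times> real) set"
  assumes G: "subspace G" and dom: "\<And>x a. (x, a) \<in> G \<Longrightarrow> a \<le> B * norm x" and B: "0 \<le> B"
  shows "\<exists>f :: 'a \<Rightarrow>\<^sub>L real. norm f \<le> B \<and> (\<forall>(x, a)\<in>G. blinfun_apply f x = a)"
proof -
  define \<A> where "\<A> = {H. subspace H \<and> G \<subseteq> H \<and> (\<forall>x a. (x, a) \<in> H \<longrightarrow> a \<le> B * norm x)}"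
  have "\<exists>M\<in>\<A>. \<forall>H\<in>\<A>. M \<subseteq> H \<longrightarrow> H = M"
  proof (rule subset_Zorn_nonempty)
    show "\<A> \<noteq> {}"
      using G dom by (auto simp: \<A>_def)
  next
    fix \<C> assume ne: "\<C> \<noteq> {}" and chain: "subset.chain \<A> \<C>"
    have sub: "\<C> \<subseteq> \<A>" and lin: "\<And>H K. H \<in> \<C> \<Longrightarrow> K \<in> \<C> \<Longrightarrow> H \<subseteq> K \<or> K \<subseteq> H"
      using chain by (auto simp: subset_chain_def)
    have "subspace (\<Union>\<C>)"
      unfolding subspace_def
    proof (intro conjI ballI allI)
      show "0 \<in> \<Union>\<C>"
        using ne sub subspace_0 by (fastforce simp: \<A>_def)
    next
      fix p q assume "p \<in> \<Union>\<C>" "q \<in> \<Union>\<C>"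
      then obtain H where "H \<in> \<C>" "p \<in> H" "q \<in> H"
        using lin by blast
      then show "p + q \<in> \<Union>\<C>"
        using sub subspace_add[of H p q] by (auto simp: \<A>_def)
    next
      fix t p assume "p \<in> \<Union>\<C>"
      then obtain H where "H \<in> \<C>" "p \<in> H" by blast
      then show "t *\<^sub>R p \<in> \<Union>\<C>"
        using sub subspace_scale[of H p t] by (auto simp: \<A>_def)
    qed
    then show "\<Union>\<C> \<in> \<A>"
      using ne sub by (fastforce simp: \<A>_def)
  qed
  then obtain M where "M \<in> \<A>" and maxM: "\<And>H. H \<in> \<A> \<Longrightarrow> M \<subseteq> H \<Longrightarrow> H = M"
    by blast
  then have M: "subspace M" "G \<subseteq> M" and Mdom: "\<And>x a. (x, a) \<in> M \<Longrightarrow> a \<le> B * norm x"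
    by (auto simp: \<A>_def)
  have total: "\<exists>a. (x, a) \<in> M" for x
  proof -
    obtain H c where H: "subspace H" "M \<subseteq> H" "(x, c) \<in> H" "\<forall>x a. (x, a) \<in> H \<longrightarrow> a \<le> B * norm x"
      using norm_dominated_graph_extend[of M B x] M Mdom B by blast
    then have "H \<in> \<A>" using M by (auto simp: \<A>_def)
    then show ?thesis using maxM H by blast
  qed
  have unique: "a = b" if "(x, a) \<in> M" "(x, b) \<in> M" for x a b
    using subspace_diff[OF M(1) that] subspace_diff[OF M(1) that(2,1)] Mdom[of 0 "a - b"] Mdom[of 0 "b - a"]
    by simp
  define g where "g x = (THE a. (x, a) \<in> M)" for x
  have g_mem: "(x, g x) \<in> M" for x
    unfolding g_def using total[of x] unique[of x] by (metis theI')
  have g_eq: "g x = a" if "(x, a) \<in> M" for x a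
    using unique[OF g_mem that] .
  have g_add: "g (x + y) = g x + g y" for x y
    using subspace_add[OF M(1) g_mem[of x] g_mem[of y]] by (intro g_eq) simp
  have g_scale: "g (t *\<^sub>R x) = t *\<^sub>R g x" for t x
    using subspace_scale[OF M(1) g_mem[of x], of t] by (intro g_eq) simp
  have g_bound: "\<bar>g x\<bar> \<le> B * norm x" for x
    using Mdom[OF g_mem[of x]] Mdom[OF g_mem[of "- x"]] g_scale[of "-1" x] by simp
  have bl: "bounded_linear g"
    using g_bound by (intro bounded_linear_intro[of _ B]) (auto simp: g_add g_scale mult.commute)
  have "norm (Blinfun g) \<le> B"
    using g_bound B by (intro norm_blinfun_bound) (auto simp: bounded_linear_Blinfun_apply[OF bl])
  moreover have "\<forall>(x, a)\<in>G. blinfun_apply (Blinfun g) x = a"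
    using M(2) g_eq by (auto simp: bounded_linear_Blinfun_apply[OF bl])
  ultimately show ?thesis by blast
qed

text \<open>
  The functional is first prescribed on the subspace generated by \<open>U\<close> and \<open>z\<close>, as
  \<open>u + t *\<^sub>R z \<mapsto> t * d\<close>; the hypothesis that \<open>z\<close> has distance at least \<open>d\<close>
  from \<open>U\<close> says precisely that it is dominated by the norm there.
\<close>

lemma separating_functional:
  fixes U :: "'a::real_normed_vector set"
  assumes U: "subspace U" and d: "0 \<le> d" and far: "\<And>u. u \<in> U \<Longrightarrow> d \<le> norm (z - u)"
  shows "\<exists>f \<in> annihilator U. norm f \<le> 1 \<and> blinfun_apply f z = d"
proof -
  define G where "G = {(u + t *\<^sub>R z, t * d) | u t. u \<in> U}"
  have "subspace G"
    unfolding subspace_def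
  proof (intro conjI ballI allI)
    show "0 \<in> G"
      using subspace_0[OF U] by (force simp: G_def zero_prod_def)
  next
    fix p q assume "p \<in> G" "q \<in> G"
    then obtain u s v t where "p = (u + s *\<^sub>R z, s * d)" "u \<in> U" "q = (v + t *\<^sub>R z, t * d)" "v \<in> U"
      by (auto simp: G_def)
    then have "p + q = ((u + v) + (s + t) *\<^sub>R z, (s + t) * d)" "u + v \<in> U"
      using U by (auto simp: algebra_simps subspace_add)
    then show "p + q \<in> G" by (auto simp: G_def)
  next
    fix s p assume "p \<in> G"
    then obtain u t where "p = (u + t *\<^sub>R z, t * d)" "u \<in> U"
      by (auto simp: G_def)
    then have "s *\<^sub>R p = (s *\<^sub>R u + (s * t) *\<^sub>R z, (s * t) * d)" "s *\<^sub>R u \<in> U"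
      using U by (auto simp: algebra_simps subspace_scale)
    then show "s *\<^sub>R p \<in> G" by (auto simp: G_def)
  qed
  moreover have "a \<le> 1 * norm x" if "(x, a) \<in> G" for x a
  proof -
    obtain u t where x: "x = u + t *\<^sub>R z" "a = t * d" "u \<in> U"
      using \<open>(x, a) \<in> G\<close> by (auto simp: G_def)
    show ?thesis
    proof (cases "t > 0")
      case True
      have "d \<le> norm (z - (- 1 / t) *\<^sub>R u)"
        using x(3) U by (intro far) (rule subspace_scale)
      then have "t * d \<le> t * norm (z - (- 1 / t) *\<^sub>R u)"
        using True by simp
      also have "\<dots> = norm (t *\<^sub>R (z - (- 1 / t) *\<^sub>R u))"
        using True by simp
      also have "t *\<^sub>R (z - (- 1 / t) *\<^sub>R u) = x"
        using True x by (simp add: algebra_simps)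
      finally show ?thesis using x by simp
    next
      case False
      then have "t * d \<le> 0" using d by (simp add: mult_nonpos_nonneg)
      then show ?thesis using x norm_ge_zero[of x] by linarith
    qed
  qed
  ultimately obtain f :: "'a \<Rightarrow>\<^sub>L real" where f: "norm f \<le> 1" "\<forall>(x, a)\<in>G. blinfun_apply f x = a"
    using hahn_banach_graph[of G 1] by auto
  have "(u, 0) \<in> G" if "u \<in> U" for u
    using that by (force simp: G_def)
  then have "f \<in> annihilator U"
    using f(2) by (fastforce simp: annihilator_def)
  moreover have "(z, d) \<in> G"
    using subspace_0[OF U] by (force simp: G_def)
  then have "blinfun_apply f z = d"
    using f(2) by auto
  ultimately show ?thesis using f(1) by blast
qed

lemma norm_le_if_functionals_le:
  fixes x :: "'a::real_normed_vector"
  assumes "\<And>f :: 'a \<Rightarrow>\<^sub>L real. norm f \<le> 1 \<Longrightarrow> blinfun_apply f x \<le> d"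
  shows "norm x \<le> d"
proof -
  obtain f where "norm f \<le> 1" "blinfun_apply f x = norm x"
    using separating_functional[of "{0}" "norm x" x] by auto
  then show ?thesis using assms[of f] by simp
qed

section \<open>Best approximation\<close>

lemma subspace_closure:
  fixes S :: "'a::real_normed_vector set"
  assumes S: "subspace S"
  shows "subspace (closure S)"
  unfolding subspace_def
proof (intro conjI ballI allI)
  show "0 \<in> closure S"
    using subspace_0[OF S] closure_subset by blast
next
  fix x y assume "x \<in> closure S" "y \<in> closure S"
  then obtain f g where f: "\<forall>n. f n \<in> S" "f \<longlonglongrightarrow> x" and g: "\<forall>n. g n \<in> S" "g \<longlonglongrightarrow> y"
    by (auto simp: closure_sequential)
  have "(\<lambda>n. f n + g n) \<longlonglongrightarrow> x + y" "\<forall>n. f n + g n \<in> S"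
    using f g S by (auto intro: tendsto_add subspace_add)
  then show "x + y \<in> closure S"
    unfolding closure_sequential by (intro exI[of _ "\<lambda>n. f n + g n"]) simp
next
  fix t x assume "x \<in> closure S"
  then obtain f where f: "\<forall>n. f n \<in> S" "f \<longlonglongrightarrow> x"
    by (auto simp: closure_sequential)
  have "(\<lambda>n. t *\<^sub>R f n) \<longlonglongrightarrow> t *\<^sub>R x" "\<forall>n. t *\<^sub>R f n \<in> S"
    using f S by (auto intro: tendsto_scaleR subspace_scale)
  then show "t *\<^sub>R x \<in> closure S"
    unfolding closure_sequential by (intro exI[of _ "\<lambda>n. t *\<^sub>R f n"]) simp
qed

text \<open>
  Evaluation at \<open>z\<close>, restricted to the annihilator of \<open>U\<close>, has norm at most the distance
  of \<open>z\<close> to \<open>U\<close>. A Hahn-Banach extension to the whole dual space with the same bound is,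
  by reflexivity, evaluation at some \<open>x\<close> with norm at most that distance. As \<open>z\<close> and
  \<open>x\<close> agree under all functionals vanishing on \<open>U\<close>, the difference \<open>z - x\<close> lies in
  \<open>U\<close>, and it is a best approximation.
\<close>

lemma best_approximation_exists:
  fixes U :: "'a::real_normed_vector set"
  assumes refl: "reflexive_space TYPE('a)" and U: "subspace U" "closed U"
  shows "\<exists>u\<in>U. norm (z - u) = infdist z U"
proof -
  have ne: "U \<noteq> {}" using subspace_0[OF U(1)] by auto
  define d where "d = infdist z U"
  define G where "G = (\<lambda>f. (f, blinfun_apply f z)) ` annihilator U"
  have "subspace G"
    unfolding subspace_def
    by (auto simp: G_def annihilator_def zero_prod_def blinfun.bilinear_simps image_iff)
  moreover have "a \<le> d * norm f" if "(f, a) \<in> G" for f :: "'a \<Rightarrow>\<^sub>L real" and a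
  proof -
    have f: "f \<in> annihilator U" "a = blinfun_apply f z"
      using \<open>(f, a) \<in> G\<close> by (auto simp: G_def)
    show ?thesis
    proof (cases "norm f = 0")
      case True
      then show ?thesis using f by simp
    next
      case False
      then have pos: "norm f > 0" by simp
      have "a / norm f \<le> dist z u" if "u \<in> U" for u
      proof -
        have "a = blinfun_apply f (z - u)"
          using f that by (simp add: annihilator_def blinfun.bilinear_simps)
        also have "\<dots> \<le> norm f * norm (z - u)"
          using norm_blinfun[of f "z - u"] by simp
        finally show ?thesis
          using pos by (simp add: dist_norm field_simps)
      qed
      then have "a / norm f \<le> d"
        unfolding d_def infdist_notempty[OF ne] using ne by (intro cINF_greatest) auto
      then show ?thesis using pos by (simp add: field_simps)
    qed
  qed
  ultimately obtain \<Phi> :: "('a \<Rightarrow>\<^sub>L real) \<Rightarrow>\<^sub>L real"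
    where \<Phi>: "norm \<Phi> \<le> d" "\<forall>(f, a)\<in>G. blinfun_apply \<Phi> f = a"
    using hahn_banach_graph[of G d] by (auto simp: d_def infdist_nonneg)
  obtain x where x: "\<And>f. blinfun_apply \<Phi> f = blinfun_apply f x"
    using refl by (auto simp: reflexive_space_def)
  have "norm x \<le> d"
  proof (rule norm_le_if_functionals_le)
    fix f :: "'a \<Rightarrow>\<^sub>L real" assume f: "norm f \<le> 1"
    have "blinfun_apply f x \<le> norm \<Phi> * norm f"
      using norm_blinfun[of \<Phi> f] x by simp
    also have "\<dots> \<le> d * 1"
      using \<Phi>(1) f by (intro mult_mono) (auto simp: d_def infdist_nonneg)
    finally show "blinfun_apply f x \<le> d" by simp
  qed
  have "z - x \<in> U"
  proof -
    obtain f where f: "f \<in> annihilator U" "blinfun_apply f (z - x) = infdist (z - x) U"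
      using separating_functional[OF U(1), of "infdist (z - x) U" "z - x"]
      by (metis dist_norm infdist_le infdist_nonneg)
    have "blinfun_apply f x = blinfun_apply f z"
      using \<Phi>(2) x f(1) by (force simp: G_def)
    then have "infdist (z - x) U = 0"
      using f(2) by (simp add: blinfun.bilinear_simps)
    then show ?thesis
      using in_closed_iff_infdist_zero[OF U(2) ne] by blast
  qed
  moreover have "norm (z - (z - x)) = d"
    using \<open>norm x \<le> d\<close> infdist_le[OF \<open>z - x \<in> U\<close>, of z] by (simp add: d_def dist_norm)
  ultimately show ?thesis unfolding d_def by blast
qed

text \<open>The midpoint of two distinct best approximations would be strictly better.\<close>

lemma best_approximation_unique:
  fixes U :: "'a::real_normed_vector set"
  assumes conv: "strictly_convex_space TYPE('a)" and U: "subspace U"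
    and u: "u \<in> U" "norm (z - u) = infdist z U" and v: "v \<in> U" "norm (z - v) = infdist z U"
  shows "u = v"
proof (rule ccontr)
  assume ne: "u \<noteq> v"
  define d where "d = infdist z U"
  have pos: "d > 0"
    using u v ne infdist_nonneg[of z U] by (cases "infdist z U = 0") (auto simp: d_def)
  have "norm ((1/d) *\<^sub>R (z - u) + (1/d) *\<^sub>R (z - v)) < 2"
    using conv pos u v ne unfolding strictly_convex_space_def
    by (simp add: d_def)
  also have "(1/d) *\<^sub>R (z - u) + (1/d) *\<^sub>R (z - v) = (2/d) *\<^sub>R (z - (1/2) *\<^sub>R (u + v))"
    by (simp add: scaleR_diff_right scaleR_add_right flip: scaleR_left_distrib)
  also have "norm \<dots> = (2/d) * norm (z - (1/2) *\<^sub>R (u + v))"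
    using pos by (simp only: norm_scaleR) simp
  finally have "norm (z - (1/2) *\<^sub>R (u + v)) < d"
    using pos by (simp only: pos_divide_less_eq times_divide_eq_left)
  moreover have "(1/2) *\<^sub>R (u + v) \<in> U"
    using U u v by (intro subspace_scale subspace_add)
  then have "d \<le> norm (z - (1/2) *\<^sub>R (u + v))"
    unfolding d_def using infdist_le by (metis dist_norm)
  ultimately show False by simp
qed

lemma metric_proj_eqI:
  fixes U :: "'a::real_normed_vector set"
  assumes conv: "strictly_convex_space TYPE('a)" and U: "subspace U"
    and u: "u \<in> U" "norm (z - u) = infdist z U"
  shows "metric_proj U z = u"
proof -
  have "infdist z U = (INF v\<in>U. norm (z - v))"
    using u(1) by (auto simp: infdist_def dist_norm)
  then show ?thesis
    unfolding metric_proj_def using u best_approximation_unique[OF conv U _ _ u]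
    by (metis (mono_tags, lifting) the_equality)
qed

text \<open>
  Translating \<open>y\<close> by an element of \<open>U\<close> does not change its distance to \<open>U\<close>, so the
  residual \<open>y - metric_proj U y\<close> is as long as it is far from \<open>U\<close>.
\<close>

lemma norm_metric_proj_residual:
  fixes U :: "'a::real_normed_vector set"
  assumes refl: "reflexive_space TYPE('a)" and conv: "strictly_convex_space TYPE('a)"
    and U: "subspace U" "closed U"
  shows "norm (y - metric_proj U y) = infdist (y - metric_proj U y) U"
proof -
  obtain p where p: "p \<in> U" "norm (y - p) = infdist y U"
    using best_approximation_exists[OF refl U] by blast
  have ne: "U \<noteq> {}" using p by auto
  have "norm (y - p) \<le> dist (y - p) u" if "u \<in> U" for u
    using infdist_le[OF subspace_add[OF U(1) p(1) that], of y] p(2)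
    by (simp add: dist_norm diff_diff_eq)
  then have "norm (y - p) \<le> infdist (y - p) U"
    unfolding infdist_notempty[OF ne] using ne by (intro cINF_greatest) auto
  moreover have "infdist (y - p) U \<le> norm (y - p)"
    using infdist_le[OF subspace_0[OF U(1)], of "y - p"] by simp
  ultimately show ?thesis
    using metric_proj_eqI[OF conv U(1) p] by simp
qed

section \<open>Residuals and the metric generalized inverse\<close>

text \<open>
  The functional of \<open>separating_functional\<close>, scaled by \<open>norm z\<close>. That its norm is exactly
  \<open>norm z\<close> follows from its value \<open>(norm z)\<^sup>2\<close> at \<open>z\<close>.
\<close>

lemma nearest_zero_imp_duality_annihilator:
  fixes U :: "'a::real_normed_vector set"
  assumes U: "subspace U" and near: "norm z = infdist z U"
  shows "duality_map z \<inter> annihilator U \<noteq> {}"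
proof -
  obtain f where f: "f \<in> annihilator U" "norm f \<le> 1" "blinfun_apply f z = norm z"
    using separating_functional[OF U, of "norm z" z] near
    by (metis dist_norm infdist_le norm_ge_zero)
  define g where "g = norm z *\<^sub>R f"
  have g: "g \<in> annihilator U" "blinfun_apply g z = (norm z)\<^sup>2"
    using f by (auto simp: g_def annihilator_def blinfun.bilinear_simps power2_eq_square)
  have "norm g \<le> norm z"
    using f(2) by (simp add: g_def mult_left_le)
  moreover have "norm z \<le> norm g"
  proof (cases "z = 0")
    case False
    have "norm z * norm z \<le> norm g * norm z"
      using norm_blinfun[of g z] g(2) by (simp add: power2_eq_square)
    then show ?thesis using False by simp
  qed simp
  ultimately have "g \<in> duality_map z"
    using g(2) by (simp add: duality_map_def)
  then show ?thesis using g(1) by blast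
qed

text \<open>
  An element of both \<open>C_X A\<close> and the null space of \<open>A\<close> is annihilated by one of its own
  duality functionals, hence is \<open>0\<close>.
\<close>

lemma inv_into_C_X_zero:
  fixes A :: "'a::real_normed_vector \<Rightarrow> 'b::real_normed_vector"
  assumes "A 0 = 0"
  shows "inv_into (C_X A) A 0 = 0"
proof -
  have "0 \<in> duality_map (0 :: 'a) \<inter> annihilator (null_space A)"
    by (simp add: duality_map_def annihilator_def)
  then have "0 \<in> C_X A"
    by (auto simp: C_X_def)
  then have im: "0 \<in> A ` C_X A"
    using assms by (metis imageI)
  define x where "x = inv_into (C_X A) A 0"
  have "x \<in> C_X A" "A x = 0"
    unfolding x_def using inv_into_into[OF im] f_inv_into_f[OF im] by auto
  then have "x = 0"
    by (auto simp: C_X_def duality_map_def annihilator_def null_space_def)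
  then show ?thesis by (simp add: x_def)
qed

theorem proposition1:
  fixes A :: "'a::banach \<Rightarrow> 'b::banach" and X :: "nat \<Rightarrow> 'b \<Rightarrow> 'a" and y :: 'b
  assumes "reflexive_space TYPE('a)" and "strictly_convex_space TYPE('a)"
    and "reflexive_space TYPE('b)" and "strictly_convex_space TYPE('b)"
    and "bounded_linear A"
    and "sequential_regularization A X"
  shows "(\<lambda>k. X k (y - metric_proj (closure (range A)) y)) \<longlonglongrightarrow> 0"
proof -
  define U where "U = closure (range A)"
  define z where "z = y - metric_proj U y"
  have lin: "linear A"
    using assms(5) by (rule bounded_linear.linear)
  have U: "subspace U" "closed U"
    unfolding U_def
    by (auto intro!: subspace_closure linear_subspace_image lin)
  have near: "norm z = infdist z U"
    unfolding z_def by (rule norm_metric_proj_residual[OF assms(3,4) U])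
  have "range A \<subseteq> U"
    unfolding U_def by (rule closure_subset)
  then have "annihilator U \<subseteq> annihilator (range A)"
    by (auto simp: annihilator_def)
  then have "z \<in> C_Y A"
    using nearest_zero_imp_duality_annihilator[OF U(1) near]
    unfolding C_Y_def by blast
  moreover have "0 \<in> range A"
    using linear_0[OF lin] by (metis rangeI)
  ultimately have "z \<in> mgi_domain A"
    unfolding mgi_domain_def by force
  then have "(\<lambda>k. X k z) \<longlonglongrightarrow> metric_gen_inverse A z"
    using assms(6) by (auto simp: sequential_regularization_def)
  moreover have "metric_proj U z = 0"
    using near subspace_0[OF U(1)] by (intro metric_proj_eqI[OF assms(4) U(1)]) auto
  then have "metric_gen_inverse A z = 0"
    unfolding metric_gen_inverse_def U_def[symmetric]
    using inv_into_C_X_zero[of A] linear_0[OF lin] by simp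
  ultimately show ?thesis
    by (simp add: z_def U_def)
qed

end
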